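(* Let $q$ be a prime power, let $n,k,d$ be positive integers with $k>d\geq 2$ and $n\geq 2k+1$, and let $V$ be an $n$-dimensional vector space over $\mathbb{F}_q$. Suppose $\mathcal{F}\subseteq \left[V\atop k\right]_q$ is an intersecting family, i.e. $\dim(F\cap F')\geq 1$ for all $F,F'\in\mathcal{F}$. Then $$\delta_d(\mathcal{F})\leq \left[n-d-1\atop k-d-1\right]_q.$$
   Context: $\left[V\atop k\right]_q$ denotes the set of all $k$-dimensional subspaces of $V$. For $m\in\mathbb{R}$ and a positive integer $k$, the Gaussian binomial coefficient is $\left[m\atop k\right]_q=\prod_{i=0}^{k-1}\frac{q^{m-i}-1}{q^{k-i}-1}$; $\left[m\atop 0\right]_q=1$ and $\left[m\atop k\right]_q=0$ for negative integers $k$. For a family $\mathcal{F}\subseteq\left[V\atop k\right]_q$ and a subspace $S\leq V$, the $S$-degree is $d_S(\mathcal{F})=|\{F\in\mathcal{F}: S\leq F\}|$, and for $1\le d\le k$ the minimum $d$-degree is $\delta_d(\mathcal{F})=\min\{d_S(\mathcal{F}): S\leq V,\ \dim S=d\}$. *)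

theory Defs
  imports Complex_Main "HOL-Library.Cardinality" "HOL-Number_Theory.Prime_Powers"
begin

text \<open>
  The vector space \<open>V\<close> is the whole type \<open>'b\<close>, with scalar multiplication \<open>scale\<close>.
\<close>

definition subspaces_of_dim ::
  "('a::field \<Rightarrow> 'b::ab_group_add \<Rightarrow> 'b) \<Rightarrow> nat \<Rightarrow> 'b set set" where
  "subspaces_of_dim scale k = {S. module.subspace scale S \<and> vector_space.dim scale S = k}"

definition intersecting_family ::
  "('a::field \<Rightarrow> 'b::ab_group_add \<Rightarrow> 'b) \<Rightarrow> 'b set set \<Rightarrow> bool" where
  "intersecting_family scale \<F> \<longleftrightarrow>
     (\<forall>F\<in>\<F>. \<forall>F'\<in>\<F>. vector_space.dim scale (F \<inter> F') \<ge> 1)"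

definition degree_of :: "'b set set \<Rightarrow> 'b set \<Rightarrow> nat" where
  "degree_of \<F> S = card {F \<in> \<F>. S \<subseteq> F}"

definition min_degree ::
  "('a::field \<Rightarrow> 'b::ab_group_add \<Rightarrow> 'b) \<Rightarrow> nat \<Rightarrow> 'b set set \<Rightarrow> nat" where
  "min_degree scale d \<F> = Min {degree_of \<F> S |S. S \<in> subspaces_of_dim scale d}"

text \<open>The lower index ranges over the integers; for \<open>k = 0\<close> the empty product gives 1.\<close>

definition gauss_binomial :: "nat \<Rightarrow> real \<Rightarrow> int \<Rightarrow> real" where
  "gauss_binomial q m k =
     (if k < 0 then 0
      else (\<Prod>i<nat k. (real q powr (m - real i) - 1) /
                         (real q powr (real_of_int k - real i) - 1)))"

end

theory Submission
  imports Defs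
begin

text \<open>
  Let \<open>t\<close> be the least dimension of a subspace \<open>W\<close> that meets all members of the family \<open>\<F>\<close>
  nontrivially, and suppose that all \<open>d\<close>-degrees exceed the bound. Counting only \<open>d\<close>-subspaces that
  miss \<open>W\<close> is efficient, because every member loses a point to \<open>W\<close>; it shows that \<open>|\<F>|\<close> exceeds
  \<open>(1 - q\<^sup>t\<^sup>+\<^sup>d / q\<^sup>n) N\<close>, where \<open>N\<close> is the number of \<open>k\<close>-subspaces through a point, and that it
  exceeds \<open>N\<close> if \<open>t = 1\<close>.

  For an upper bound, a subspace of dimension less than \<open>t\<close> is missed by some member, so the members
  containing it contain one more vector of that member. Iterating this up to dimension \<open>t\<close> contradicts
  the lower bound unless \<open>q = 2\<close> and \<open>n = 2 k + 1\<close>. In that case take two points \<open>p\<close> and \<open>r\<close>. The members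
  through \<open>p\<close> but not \<open>r\<close> and those through \<open>r\<close> but not \<open>p\<close> form cross-intersecting families. A large
  covering number of one forces the other one to be small, and a small covering number of a family
  forces the family itself to be small; balancing the two, the smaller family has at most about
  \<open>N / 2\<^sup>k\<^sup>-\<^sup>1\<close> members. So all points of \<open>W\<close> but one contribute next to nothing to \<open>|\<F>|\<close>.
\<close>

section \<open>Products of Gaussian type\<close>

text \<open>The number of \<open>k\<close>-dimensional subspaces of an \<open>n\<close>-dimensional space over a field with \<open>q\<close> elements
  that contain a given \<open>j\<close>-dimensional subspace, for \<open>j \<le> k \<le> n\<close>.\<close>

definition star_size :: "real \<Rightarrow> nat \<Rightarrow> nat \<Rightarrow> nat \<Rightarrow> real" where
  "star_size q n k j = (\<Prod>i=j..<k. (q ^ n - q ^ i) / (q ^ k - q ^ i))"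

lemma star_size_self [simp]: "star_size q n k k = 1"
  by (simp add: star_size_def)

lemma star_size_Suc:
  assumes "j < k"
  shows "star_size q n k j = (q ^ n - q ^ j) / (q ^ k - q ^ j) * star_size q n k (Suc j)"
  using assms by (simp add: star_size_def prod.atLeast_Suc_lessThan)

lemma star_size_pos:
  assumes "q > 1" "k \<le> n"
  shows "star_size q n k j > 0"
  unfolding star_size_def using assms
  by (intro prod_pos divide_pos_pos) (auto intro: power_strict_increasing)

text \<open>Expanding each factor of the Gaussian coefficient by \<open>q ^ (i + Suc d)\<close>
  gives the factor of \<open>star_size\<close> with index \<open>i + Suc d\<close>. So the claimed
  bound is the number of \<open>k\<close>-subspaces through a given subspace of dimension
  \<open>d + 1\<close>.\<close>

lemma gauss_binomial_eq_star_size: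
  assumes "q > 1" "d < k" "k \<le> n"
  shows "gauss_binomial q (real n - real d - 1) (int k - int d - 1) = star_size (real q) n k (Suc d)"
proof -
  have *: "(real q powr (real n - real d - 1 - real i) - 1) /
      (real q powr (real_of_int (int k - int d - 1) - real i) - 1) =
      (real q ^ n - real q ^ (i + Suc d)) / (real q ^ k - real q ^ (i + Suc d))"
    if "i < k - Suc d" for i
  proof -
    have "real n - real d - 1 - real i = real (n - (i + Suc d))"
      "real_of_int (int k - int d - 1) - real i = real (k - (i + Suc d))"
      using that assms by (auto simp: of_nat_diff)
    then have e: "real q powr (real n - real d - 1 - real i) = real q ^ (n - (i + Suc d))"
      "real q powr (real_of_int (int k - int d - 1) - real i) = real q ^ (k - (i + Suc d))"
      using assms by (metis of_nat_0_less_iff order_less_trans powr_realpow zero_less_one)+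
    have "real q ^ n - real q ^ (i + Suc d) = real q ^ (i + Suc d) * (real q ^ (n - (i + Suc d)) - 1)"
      "real q ^ k - real q ^ (i + Suc d) = real q ^ (i + Suc d) * (real q ^ (k - (i + Suc d)) - 1)"
      using that assms
      by (simp_all add: right_diff_distrib del: add_Suc_right power_Suc flip: power_add)
    moreover have "real q ^ (i + Suc d) \<noteq> 0" using assms by simp
    ultimately show ?thesis unfolding e by simp
  qed
  have "nat (int k - int d - 1) = k - Suc d" by simp
  then have "gauss_binomial q (real n - real d - 1) (int k - int d - 1) =
      (\<Prod>i<k - Suc d. (real q ^ n - real q ^ (i + Suc d)) / (real q ^ k - real q ^ (i + Suc d)))"
    unfolding gauss_binomial_def using * assms by (auto intro!: prod.cong)
  also have "\<dots> = star_size (real q) n k (Suc d)"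
    unfolding star_size_def using assms
    by (intro prod.reindex_bij_witness[where i="\<lambda>i. i - Suc d" and j="\<lambda>i. i + Suc d"]) auto
  finally show ?thesis .
qed

section \<open>Star sizes of different dimensions\<close>

text \<open>Raising \<open>j\<close> by one divides the star size by
  \<open>(q ^ n - q ^ j) / (q ^ k - q ^ j)\<close>, while a chain step costs a factor
  \<open>q ^ k - 1\<close>; \<open>c j\<close> bounds the net effect. This turns chain bounds at
  dimension \<open>s\<close> into fractions of the star size of a point.\<close>

lemma power_star_size_le:
  assumes "q > 1" "1 \<le> s" "s \<le> k" "k \<le> n"
    and c: "\<And>j. 1 \<le> j \<Longrightarrow> j < s \<Longrightarrow> (q ^ k - 1) * (q ^ k - q ^ j) \<le> c j * (q ^ n - q ^ j)"
  shows "(q ^ k - 1) ^ (s - 1) * star_size q n k s \<le> (\<Prod>j=1..<s. c j) * star_size q n k 1"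
  using assms(2,3) c
proof (induction s rule: dec_induct)
  case base
  then show ?case by simp
next
  case (step j)
  have lt: "q ^ j < q ^ k" "q ^ j < q ^ n"
    using step assms by (auto intro!: power_strict_increasing)
  have pos: "star_size q n k (Suc j) > 0" using star_size_pos assms by simp
  have "(q ^ k - 1) * star_size q n k (Suc j) \<le> c j * star_size q n k j"
  proof -
    have "(q ^ k - 1) * (q ^ k - q ^ j) / (q ^ k - q ^ j) \<le> c j * (q ^ n - q ^ j) / (q ^ k - q ^ j)"
      using step lt by (intro divide_right_mono) auto
    then have "q ^ k - 1 \<le> c j * ((q ^ n - q ^ j) / (q ^ k - q ^ j))" using lt by simp
    then have "(q ^ k - 1) * star_size q n k (Suc j) \<le>
        c j * ((q ^ n - q ^ j) / (q ^ k - q ^ j)) * star_size q n k (Suc j)"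
      using pos by (intro mult_right_mono) auto
    then show ?thesis using step star_size_Suc[of j k q n] by (simp add: mult.assoc)
  qed
  moreover have "(q ^ k - 1) ^ j = (q ^ k - 1) ^ (j - 1) * (q ^ k - 1)"
    using step by (simp flip: power_Suc2)
  ultimately have "(q ^ k - 1) ^ j * star_size q n k (Suc j) \<le>
      (q ^ k - 1) ^ (j - 1) * (c j * star_size q n k j)"
    using assms by (simp add: mult.assoc mult_left_mono)
  also have "\<dots> = c j * ((q ^ k - 1) ^ (j - 1) * star_size q n k j)" by simp
  also have "\<dots> \<le> c j * ((\<Prod>j=1..<j. c j) * star_size q n k 1)"
  proof (rule mult_left_mono)
    \<comment> \<open>The sign of \<open>c j\<close> is forced by the hypothesis on
      \<open>c\<close>, whose left side is nonnegative.\<close>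
    have "0 \<le> (q ^ k - 1) * (q ^ k - q ^ j)" using lt assms by (intro mult_nonneg_nonneg) auto
    then have "0 \<le> c j * (q ^ n - q ^ j)" using step by fastforce
    then show "c j \<ge> 0" using lt by (simp add: zero_le_mult_iff)
  qed (use step in auto)
  finally show ?case using step by (simp add: ac_simps)
qed

text \<open>The Weierstrass product inequality.\<close>

lemma prod_one_minus_ge:
  fixes x :: "nat \<Rightarrow> real"
  assumes "\<And>i. i < d \<Longrightarrow> 0 \<le> x i" "\<And>i. i < d \<Longrightarrow> x i \<le> 1"
  shows "1 - (\<Sum>i<d. x i) \<le> (\<Prod>i<d. 1 - x i)"
  using assms
proof (induction d)
  case (Suc d)
  have IH: "1 - (\<Sum>i<d. x i) \<le> (\<Prod>i<d. 1 - x i)" using Suc by simp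
  have "(\<Prod>i<d. 1 - x i) \<le> 1" using Suc.prems by (intro prod_le_1) auto
  then have "x d * (\<Prod>i<d. 1 - x i) \<le> x d * 1" using Suc.prems by (intro mult_left_mono) auto
  then show ?case using IH by (simp add: algebra_simps)
qed simp

text \<open>Expresses the lower count through the star size of a point: the \<open>d\<close> factors
  between the two star sizes exchange the denominators \<open>q ^ k - q ^ Suc i\<close> for
  \<open>q ^ n - q ^ Suc i\<close>.\<close>

lemma star_size_split:
  assumes "q > 1" "d < k" "k \<le> n"
  shows "star_size q n k (Suc d) * (\<Prod>i<d. (q ^ n - q ^ (t + i)) / (q ^ k - q ^ Suc i)) =
    star_size q n k 1 * (\<Prod>i<d. (q ^ n - q ^ (t + i)) / (q ^ n - q ^ Suc i))"
proof -
  have "star_size q n k 1 = (\<Prod>i=1..<Suc d. (q ^ n - q ^ i) / (q ^ k - q ^ i)) * star_size q n k (Suc d)"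
    unfolding star_size_def using assms by (intro prod.atLeastLessThan_concat[symmetric]) auto
  also have "(\<Prod>i=1..<Suc d. (q ^ n - q ^ i) / (q ^ k - q ^ i)) =
      (\<Prod>i<d. (q ^ n - q ^ Suc i) / (q ^ k - q ^ Suc i))"
    using prod.shift_bounds_Suc_ivl[of "\<lambda>i. (q ^ n - q ^ i) / (q ^ k - q ^ i)" 0 d]
    by (simp add: lessThan_atLeast0)
  finally have "star_size q n k 1 * (\<Prod>i<d. (q ^ n - q ^ (t + i)) / (q ^ n - q ^ Suc i)) =
      star_size q n k (Suc d) * (\<Prod>i<d. (q ^ n - q ^ Suc i) / (q ^ k - q ^ Suc i) *
        ((q ^ n - q ^ (t + i)) / (q ^ n - q ^ Suc i)))"
    by (simp only: prod.distrib ac_simps)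
  also have "(\<Prod>i<d. (q ^ n - q ^ Suc i) / (q ^ k - q ^ Suc i) *
        ((q ^ n - q ^ (t + i)) / (q ^ n - q ^ Suc i))) =
      (\<Prod>i<d. (q ^ n - q ^ (t + i)) / (q ^ k - q ^ Suc i))"
  proof (rule prod.cong)
    fix i assume "i \<in> {..<d}"
    then have "q ^ Suc i < q ^ n" using assms by (intro power_strict_increasing) auto
    then show "(q ^ n - q ^ Suc i) / (q ^ k - q ^ Suc i) * ((q ^ n - q ^ (t + i)) / (q ^ n - q ^ Suc i)) =
        (q ^ n - q ^ (t + i)) / (q ^ k - q ^ Suc i)" by simp
  qed simp
  finally show ?thesis by simp
qed

text \<open>Each factor is at least \<open>1 - q ^ (t + i) / q ^ n\<close>; the Weierstrass
  inequality then leaves a geometric sum, controlled by \<open>q \<ge> 2\<close>.\<close>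

lemma prod_ratio_ge:
  assumes "q \<ge> 2" "d < n" "t + d \<le> n"
  shows "1 - q ^ (t + d) / q ^ n \<le> (\<Prod>i<d. (q ^ n - q ^ (t + i)) / (q ^ n - q ^ Suc i :: real))"
proof -
  have "(\<Sum>i<d. q ^ i) \<le> q ^ d"
  proof (induction d)
    case (Suc d)
    have "2 * q ^ d \<le> q * q ^ d" using assms by (intro mult_right_mono) auto
    then show ?case using Suc by simp
  qed simp
  then have "(\<Sum>i<d. q ^ (t + i) / q ^ n) \<le> q ^ (t + d) / q ^ n"
    using assms by (simp add: power_add divide_right_mono flip: sum_divide_distrib sum_distrib_left)
  then have "1 - q ^ (t + d) / q ^ n \<le> 1 - (\<Sum>i<d. q ^ (t + i) / q ^ n)" by simp
  also have "\<dots> \<le> (\<Prod>i<d. 1 - q ^ (t + i) / q ^ n)"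
    using assms by (intro prod_one_minus_ge) (auto intro!: power_increasing)
  also have "\<dots> \<le> (\<Prod>i<d. (q ^ n - q ^ (t + i)) / (q ^ n - q ^ Suc i))"
  proof (rule prod_mono, intro conjI)
    fix i assume i: "i \<in> {..<d}"
    have le: "q ^ (t + i) \<le> q ^ n" using i assms by (intro power_increasing) auto
    then show "0 \<le> 1 - q ^ (t + i) / q ^ n" using assms by simp
    have "q ^ Suc i < q ^ n" using i assms by (intro power_strict_increasing) auto
    then have "(q ^ n - q ^ (t + i)) / q ^ n \<le> (q ^ n - q ^ (t + i)) / (q ^ n - q ^ Suc i)"
      using le assms by (intro divide_left_mono) auto
    then show "1 - q ^ (t + i) / q ^ n \<le> (q ^ n - q ^ (t + i)) / (q ^ n - q ^ Suc i)"
      using assms by (simp add: diff_divide_distrib)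
  qed
  finally show ?thesis .
qed

section \<open>Numerical bounds outside the case \<open>q = 2\<close>,
  \<open>n = 2 k + 1\<close>\<close>

text \<open>The induction works because \<open>(q + 1) * (q ^ t - 1)\<close> exceeds
  \<open>q ^ Suc t - 1\<close> by \<open>q ^ t - q\<close>. The exponent \<open>t - 1\<close>
  spreads the points of a \<open>t\<close>-dimensional space evenly over the \<open>t - 1\<close>
  chain steps.\<close>

lemma geometric_le_power:
  assumes "q \<ge> (1::real)" "1 \<le> t"
  shows "q ^ t - 1 \<le> (q - 1) * (q + 1) ^ (t - 1)"
  using assms(2)
proof (induction t rule: dec_induct)
  case (step t)
  have "q ^ Suc t - 1 \<le> (q + 1) * (q ^ t - 1)"
    using step self_le_power[of q t] assms by (simp add: algebra_simps)
  also have "\<dots> \<le> (q + 1) * ((q - 1) * (q + 1) ^ (t - 1))"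
    using step assms by (intro mult_left_mono) auto
  also have "\<dots> = (q - 1) * (q + 1) ^ t" using step by (simp add: ac_simps flip: power_Suc)
  finally show ?case using step by simp
qed simp

text \<open>Every chain step now costs the same factor; \<open>c j = q ^ (2 * k) / q ^ n\<close> is
  admissible in \<open>power_star_size_le\<close> because \<open>k \<le> n\<close>.\<close>

lemma easy_size_bound:
  assumes "q > 1" "1 \<le> t" "t \<le> k" "k \<le> n"
    and f: "(q - 1) ^ t * f \<le> (q ^ t - 1) * (q ^ k - 1) ^ (t - 1) * star_size q n k t"
  shows "f \<le> ((q + 1) * (q ^ (2 * k) / q ^ n) / (q - 1)) ^ (t - 1) * star_size q n k 1"
proof -
  let ?c = "q ^ (2 * k) / q ^ n"
  have N: "star_size q n k 1 > 0" using star_size_pos assms by simp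
  have "(q ^ k - 1) ^ (t - 1) * star_size q n k t \<le> (\<Prod>j=1..<t. ?c) * star_size q n k 1"
  proof (rule power_star_size_le)
    fix j assume j: "1 \<le> j" "j < t"
    have "(q ^ k - 1) * (q ^ k - q ^ j) \<le> q ^ k * (q ^ k - q ^ j)"
      using j assms by (intro mult_right_mono) (auto intro!: power_increasing)
    also have "\<dots> = q ^ (2 * k) - q ^ k * q ^ j" by (simp add: right_diff_distrib mult_2 power_add)
    also have "q ^ k / q ^ n \<le> 1" using assms by (simp add: power_increasing)
    then have "q ^ k / q ^ n * (q ^ k * q ^ j) \<le> 1 * (q ^ k * q ^ j)"
      using assms by (intro mult_right_mono) auto
    then have "q ^ (2 * k) - q ^ k * q ^ j \<le> ?c * (q ^ n - q ^ j)"
      using assms by (simp add: right_diff_distrib mult_2 power_add)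
    finally show "(q ^ k - 1) * (q ^ k - q ^ j) \<le> ?c * (q ^ n - q ^ j)" .
  qed (use assms in auto)
  then have "(q ^ t - 1) * ((q ^ k - 1) ^ (t - 1) * star_size q n k t) \<le>
      ((q - 1) * (q + 1) ^ (t - 1)) * (?c ^ (t - 1) * star_size q n k 1)"
    using assms less_imp_le[OF star_size_pos[of q k n t]] geometric_le_power[of q t]
    by (intro mult_mono[of "q ^ t - 1"]) auto
  then have "(q - 1) ^ t * f \<le> (q - 1) * (q + 1) ^ (t - 1) * ?c ^ (t - 1) * star_size q n k 1"
    using f by (simp add: mult.assoc)
  moreover have "(q - 1) ^ t = (q - 1) * (q - 1) ^ (t - 1)" using assms by (simp flip: power_Suc)
  ultimately have "(q - 1) * ((q - 1) ^ (t - 1) * f) \<le>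
      (q - 1) * ((q + 1) ^ (t - 1) * ?c ^ (t - 1) * star_size q n k 1)"
    by (simp add: mult.assoc)
  then have "(q - 1) ^ (t - 1) * f \<le> (q + 1) ^ (t - 1) * ?c ^ (t - 1) * star_size q n k 1"
    using assms by (simp only: mult_le_cancel_left_pos)
  then have "f \<le> (q + 1) ^ (t - 1) * ?c ^ (t - 1) * star_size q n k 1 / (q - 1) ^ (t - 1)"
    using assms by (simp add: pos_le_divide_eq mult.commute)
  then show ?thesis by (simp add: power_mult_distrib power_divide)
qed

text \<open>At worst the factor is \<open>(q + 1) / (q * (q - 1))\<close>, which is 2/3 at
  \<open>q = 3\<close>, or \<open>3 * (1 / 4)\<close> at \<open>q = 2\<close>. For
  \<open>q = 2\<close> and \<open>n = 2 * k + 1\<close> it is 3/2, hence the separate treatment of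
  that case.\<close>

lemma easy_factor_le:
  assumes "q \<ge> 3 \<and> 2 * k + 1 \<le> n \<or> q = 2 \<and> 2 * k + 2 \<le> n"
  shows "(q + 1) * (q ^ (2 * k) / q ^ n) / (q - 1 :: real) \<le> 3 / 4"
  using assms
proof
  assume q: "q \<ge> 3 \<and> 2 * k + 1 \<le> n"
  then have "q ^ (2 * k) * q \<le> q ^ n" using power_increasing[of "2 * k + 1" n q] by (simp add: mult.commute)
  then have "q ^ (2 * k) / q ^ n \<le> 1 / q" using q by (simp add: field_simps)
  then have "(q + 1) * (q ^ (2 * k) / q ^ n) / (q - 1) \<le> (q + 1) * (1 / q) / (q - 1)"
    using q by (intro divide_right_mono mult_left_mono) auto
  also have "\<dots> \<le> 3 / 4"
  proof -
    have "4 * (q + 1) \<le> 3 * (q * 2)" using q by simp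
    also have "\<dots> \<le> 3 * (q * (q - 1))" using q by (intro mult_left_mono) auto
    finally have "4 * (q + 1) \<le> 3 * (q * (q - 1))" .
    moreover have "q * (q - 1) > 0" using q by simp
    ultimately show ?thesis by (simp add: divide_le_eq)
  qed
  finally show ?thesis .
next
  assume q: "q = 2 \<and> 2 * k + 2 \<le> n"
  then have "2 ^ (2 * k) * 4 \<le> (2::real) ^ n" using power_increasing[of "2 * k + 2" n "2::real"] by simp
  then have "2 ^ (2 * k) / 2 ^ n \<le> (1::real) / 4" by (simp add: field_simps)
  then have "3 * (2 ^ (2 * k) / 2 ^ n) \<le> 3 * ((1::real) / 4)" by (intro mult_left_mono) auto
  then show ?thesis unfolding conjunct1[OF q] by (simp only: diff_numeral_special) simp
qed

section \<open>The numerical bounds for \<open>q = 2\<close>, \<open>n = 2 k + 1\<close>\<close>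

text \<open>For \<open>q = 2\<close> and \<open>n = 2 k + 1\<close> every step of the chain argument halves the number of members;
  \<open>loss\<close> collects the lower order factors, which decide the cases where \<open>t\<close> is close to \<open>k\<close>.\<close>

definition loss :: "nat \<Rightarrow> nat \<Rightarrow> real" where
  "loss k s = (\<Prod>j=1..<s. 1 - 2 ^ j / 2 ^ k)"

lemma loss_antimono:
  assumes "1 \<le> t" "t \<le> s" "s \<le> k"
  shows "loss k s \<le> loss k t"
proof -
  have "loss k s = loss k t * (\<Prod>j=t..<s. 1 - 2 ^ j / 2 ^ k)"
    unfolding loss_def using assms by (intro prod.atLeastLessThan_concat[symmetric]) auto
  also have "\<dots> \<le> loss k t * 1"
  proof (rule mult_left_mono)
    show "(\<Prod>j=t..<s. 1 - 2 ^ j / 2 ^ k) \<le> (1::real)"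
      using assms by (intro prod_le_1) (auto intro!: power_increasing)
    show "0 \<le> loss k t"
      unfolding loss_def using assms by (intro prod_nonneg) (auto intro!: power_increasing)
  qed
  finally show ?thesis by simp
qed

lemma loss_nonneg:
  assumes "s \<le> k" shows "0 \<le> loss k s"
  unfolding loss_def using assms by (intro prod_nonneg) (auto intro!: power_increasing)

lemma binary_star_size_le:
  assumes "1 \<le> s" "s \<le> k"
  shows "(2 ^ k - 1) ^ (s - 1) * star_size 2 (2 * k + 1) k s \<le>
    2 / 2 ^ s * loss k s * star_size 2 (2 * k + 1) k 1"
proof -
  have "(2 ^ k - 1) ^ (s - 1) * star_size 2 (2 * k + 1) k s \<le>
      (\<Prod>j=1..<s. 1 / 2 * (1 - 2 ^ j / 2 ^ k)) * star_size 2 (2 * k + 1) k 1"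
  proof (rule power_star_size_le)
    fix j assume j: "1 \<le> j" "j < s"
    define K J where "K = (2::real) ^ k" and "J = (2::real) ^ j"
    have *: "0 < J" "J \<le> K" unfolding K_def J_def using j assms by (auto intro!: power_increasing)
    \<comment> \<open>\<open>2 * K ^ 2\<close> is \<open>2 ^ (2 * k + 1)\<close>. The target factors
      as \<open>(K - J / (2 * K)) * (K - J)\<close>, so \<open>J \<le> 2 * K\<close>
      suffices.\<close>
    have "(K - 1) * (K - J) \<le> (K - J / (2 * K)) * (K - J)"
      using * by (intro mult_right_mono) (auto simp: field_simps)
    also have "\<dots> = 1 / 2 * (1 - J / K) * (2 * K ^ 2 - J)"
      using * by (simp add: field_simps power2_eq_square)
    finally show "(2 ^ k - 1) * (2 ^ k - 2 ^ j) \<le> 1 / 2 * (1 - 2 ^ j / 2 ^ k) * ((2::real) ^ (2 * k + 1) - 2 ^ j)"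
      unfolding K_def J_def by (simp add: power_mult mult.commute[of 2 k])
  qed (use assms in auto)
  also have "(\<Prod>j=1..<s. 1 / 2 * (1 - 2 ^ j / 2 ^ k)) = (1 / 2) ^ (s - 1) * loss k s"
    unfolding loss_def prod.distrib by simp
  also have "(1 / 2 :: real) ^ (s - 1) = 2 / 2 ^ s"
    using assms by (cases s) (auto simp: power_divide)
  finally show ?thesis .
qed

text \<open>Eliminates \<open>s\<close>: multiplied by \<open>2 ^ k - 1\<close>, the hypothesis fits
  \<open>binary_star_size_le\<close>, and \<open>(2 ^ s - 1) / 2 ^ s\<close> is at most
  \<open>(2 ^ k - 1) / 2 ^ k\<close>, which gives the factor \<open>2 ^ k - 1\<close> back.\<close>

lemma binary_exclusive_bound:
  assumes "1 \<le> t" "2 \<le> s" "t \<le> s" "s \<le> k"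
    and x: "x \<le> (2 ^ s - 1) * (2 ^ k - 1) ^ (s - 2) * star_size 2 (2 * k + 1) k s"
  shows "x \<le> 2 / 2 ^ k * loss k t * star_size 2 (2 * k + 1) k 1"
proof -
  let ?G = "star_size 2 (2 * k + 1) k"
  have N: "0 \<le> ?G 1" using less_imp_le[OF star_size_pos] by simp
  have K: "(2::real) ^ k > 1" using assms by (intro one_less_power) auto
  have ks: "(2::real) ^ s \<le> 2 ^ k" using assms by (intro power_increasing) auto
  have "(2 ^ k - 1) * x \<le> (2 ^ k - 1) * ((2 ^ s - 1) * (2 ^ k - 1) ^ (s - 2) * ?G s)"
    using x K by (intro mult_left_mono) auto
  also have "\<dots> = (2 ^ s - 1) * ((2 ^ k - 1) ^ (s - 1) * ?G s)"
    using assms(2) by (auto simp: nat_le_iff_add)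
  also have "\<dots> \<le> (2 ^ s - 1) * (2 / 2 ^ s * loss k s * ?G 1)"
    using binary_star_size_le[of s k] assms by (intro mult_left_mono) auto
  also have "\<dots> \<le> (2 ^ s - 1) * (2 / 2 ^ s * loss k t * ?G 1)"
    using loss_antimono[of t s k] N assms by (intro mult_left_mono mult_right_mono) auto
  also have "\<dots> = ((2 ^ s - 1) / 2 ^ s) * (2 * loss k t * ?G 1)" by simp
  also have "\<dots> \<le> ((2 ^ k - 1) / 2 ^ k) * (2 * loss k t * ?G 1)"
  proof (rule mult_right_mono)
    show "(2 ^ s - 1) / 2 ^ s \<le> ((2 ^ k - 1) / 2 ^ k :: real)"
      using ks by (simp add: diff_divide_distrib divide_left_mono)
  qed (use N loss_nonneg[of t k] assms in auto)
  also have "\<dots> = (2 ^ k - 1) * (2 / 2 ^ k * loss k t * ?G 1)" by simp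
  finally show ?thesis using K by (simp only: mult_le_cancel_left_pos)
qed

text \<open>The bracket collects one heavy point and \<open>2 ^ t - 2\<close> light ones; the right
  side is \<open>1 - 2 ^ (t + d) / 2 ^ (2 * k + 1)\<close> at the extreme \<open>d = k - 1\<close>.
  For \<open>t\<close> near \<open>k\<close> the bracket alone is too large and the last factors of
  \<open>loss\<close> decide.\<close>

lemma binary_factor_le:
  assumes "2 \<le> t" "t \<le> k" "3 \<le> k"
  shows "loss k t * (2 / 2 ^ t + (2 ^ t - 2) * (2 / 2 ^ k)) \<le> 1 - 2 ^ t / (4 * 2 ^ k)"
proof -
  have l1: "loss k t \<le> 1" using loss_antimono[of 1 t k] assms by (simp add: loss_def)
  consider "t = k" | "Suc t = k" | "t + 2 \<le> k" using assms by linarith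
  then show ?thesis
  proof cases
    case 1
    obtain l where l: "k = Suc (Suc (Suc l))"
      using assms(3) by (metis add_Suc add_0 le_Suc_ex numeral_3_eq_3)
    \<comment> \<open>The factors for \<open>j = k - 2\<close> and \<open>j = k - 1\<close>, both
      present because \<open>k \<ge> 3\<close>, make up for a bracket close to 2.\<close>
    have "loss k t = loss k (Suc l) * (3 / 4) * (1 / 2)"
      unfolding loss_def 1 l by (simp add: field_simps)
    moreover have "loss k (Suc l) \<le> 1" using loss_antimono[of 1 "Suc l" k] l by (simp add: loss_def)
    ultimately have "loss k t \<le> 3 / 8" by simp
    moreover have "2 / 2 ^ t + (2 ^ t - 2) * (2 / 2 ^ k) = 2 - 2 / (2::real) ^ k"
      unfolding 1 by (simp add: field_simps)
    moreover have "(2::real) ^ k \<ge> 1" by simp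
    then have "2 / (2::real) ^ k \<le> 2" by (simp add: field_simps)
    ultimately have "loss k t * (2 / 2 ^ t + (2 ^ t - 2) * (2 / 2 ^ k)) \<le> 3 / 8 * (2 - 2 / (2::real) ^ k)"
      by (simp only:) (intro mult_right_mono, auto)
    also have "\<dots> \<le> 3 / 4" by simp
    finally show ?thesis using 1 by simp
  next
    case 2
    obtain l where l: "t = Suc (Suc l)" using assms(1) by (metis add_2_eq_Suc le_Suc_ex)
    have "loss k t = loss k (Suc l) * (3 / 4)"
      unfolding loss_def 2[symmetric] l by (simp add: field_simps)
    moreover have "loss k (Suc l) \<le> 1" using loss_antimono[of 1 "Suc l" k] l 2 by (simp add: loss_def)
    ultimately have "loss k t \<le> 3 / 4" by simp
    moreover have "2 / 2 ^ t + (2 ^ t - 2) * (2 / 2 ^ k) = (1::real)"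
      unfolding 2[symmetric] by (simp add: field_simps)
    moreover have "2 ^ t / (4 * 2 ^ k) = (1 / 8 :: real)" unfolding 2[symmetric] by simp
    ultimately show ?thesis by (simp only:)
  next
    case 3
    define u K where "u = (2::real) ^ t" and "K = (2::real) ^ k"
    have u: "u \<ge> 4" unfolding u_def using assms power_increasing[of 2 t "2::real"] by simp
    have uK: "4 * u \<le> K" unfolding u_def K_def using 3 power_increasing[of "t + 2" k "2::real"] by simp
    have "2 / u + (u - 2) * (2 / K) \<le> 3 / 4"
    proof -
      \<comment> \<open>The bracket is convex in \<open>u\<close> with the same value
        \<open>1 / 2 + 4 / K\<close> at \<open>u = 4\<close> and \<open>u = K / 4\<close>; the
        product says that it is no larger in between. Moreover \<open>K \<ge> 16\<close>.\<close>
      have "0 \<le> (u - 4) * (K - 4 * u)" using u uK by simp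
      then have "4 * K + 4 * u * u \<le> u * K + 16 * u" by (simp add: algebra_simps)
      moreover have "16 * u \<le> u * K" using u uK by simp
      ultimately have "8 * K + 8 * (u - 2) * u \<le> 3 * (u * K)" by (simp add: algebra_simps)
      then show ?thesis using u uK by (simp add: field_simps)
    qed
    moreover have "0 \<le> 2 / u + (u - 2) * (2 / K)" using u uK by simp
    ultimately have "loss k t * (2 / u + (u - 2) * (2 / K)) \<le> 1 * (3 / 4)"
      using l1 by (intro mult_mono) auto
    moreover have "u / (4 * K) \<le> 1 / 16" using u uK by (simp add: field_simps)
    ultimately have "loss k t * (2 / u + (u - 2) * (2 / K)) \<le> 1 - u / (4 * K)" by linarith
    then show ?thesis unfolding u_def K_def .
  qed
qed

section \<open>Counting in vector spaces over finite fields\<close>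

lemma sum_card_Int_eq_sum_degree:
  assumes "finite \<A>" "finite X"
  shows "(\<Sum>F\<in>\<A>. card (F \<inter> X)) = (\<Sum>x\<in>X. card {F \<in> \<A>. x \<in> F})"
  using sum_multicount_gen[of \<A> X "\<lambda>F x. x \<in> F" "\<lambda>x. card {F \<in> \<A>. x \<in> F}"] assms
  by (simp add: Int_def conj_commute)

lemma double_count_upper:
  assumes "finite \<A>" "finite X"
    and "\<And>F. F \<in> \<A> \<Longrightarrow> m \<le> real (card (F \<inter> X))"
    and "\<And>x. x \<in> X \<Longrightarrow> real (card {F \<in> \<A>. x \<in> F}) \<le> D"
  shows "m * real (card \<A>) \<le> real (card X) * D"
proof -
  have "m * real (card \<A>) = (\<Sum>F\<in>\<A>. m)" by simp
  also have "\<dots> \<le> (\<Sum>F\<in>\<A>. real (card (F \<inter> X)))" using assms by (intro sum_mono) auto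
  also have "\<dots> = (\<Sum>x\<in>X. real (card {F \<in> \<A>. x \<in> F}))"
    using sum_card_Int_eq_sum_degree[OF assms(1,2)] by (simp flip: of_nat_sum)
  also have "\<dots> \<le> (\<Sum>x\<in>X. D)" using assms by (intro sum_mono) auto
  finally show ?thesis by simp
qed

lemma double_count_lower:
  assumes "finite \<A>" "finite X"
    and "\<And>F. F \<in> \<A> \<Longrightarrow> real (card (F \<inter> X)) \<le> m"
    and "\<And>x. x \<in> X \<Longrightarrow> D \<le> real (card {F \<in> \<A>. x \<in> F})"
  shows "real (card X) * D \<le> m * real (card \<A>)"
proof -
  have "real (card X) * D = (\<Sum>x\<in>X. D)" by simp
  also have "\<dots> \<le> (\<Sum>x\<in>X. real (card {F \<in> \<A>. x \<in> F}))" using assms by (intro sum_mono) auto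
  also have "\<dots> = (\<Sum>F\<in>\<A>. real (card (F \<inter> X)))"
    using sum_card_Int_eq_sum_degree[OF assms(1,2)] by (simp flip: of_nat_sum)
  also have "\<dots> \<le> (\<Sum>F\<in>\<A>. m)" using assms by (intro sum_mono) auto
  finally show ?thesis by (simp add: mult.commute)
qed

text \<open>Between subspaces this is \<open>dim (A \<inter> B) \<ge> 1\<close>; the counting works
  with the witness vector.\<close>

definition meets :: "'b::zero set \<Rightarrow> 'b set \<Rightarrow> bool" where
  "meets A B \<longleftrightarrow> (\<exists>v. v \<in> A \<and> v \<in> B \<and> v \<noteq> 0)"

locale finite_field_space = finite_dimensional_vector_space scale Basis
  for scale :: "'a::{field,finite} \<Rightarrow> 'b::ab_group_add \<Rightarrow> 'b" and Basis :: "'b set" +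
  fixes q :: real
  assumes q_eq: "q = real CARD('a)"
begin

abbreviation n :: nat where "n \<equiv> card Basis"

lemma q_gt_1: "q > 1"
proof -
  have "card {0, 1::'a} \<le> CARD('a)" by (intro card_mono) auto
  then show ?thesis by (simp add: q_eq)
qed

section \<open>Cardinalities of subspaces\<close>

lemma card_span_independent:
  assumes "finite B" "independent B"
  shows "finite (span B) \<and> card (span B) = CARD('a) ^ card B"
  using assms
proof (induction B rule: finite_induct)
  case empty
  then show ?case by simp
next
  case (insert x B)
  then have x: "x \<notin> span B" and B: "independent B"
    by (auto simp: independent_insert split: if_splits)
  let ?f = "\<lambda>(c, y). scale c x + y"
  have im: "span (insert x B) = ?f ` (UNIV \<times> span B)"
  proof (intro equalityI subsetI)
    fix z assume "z \<in> span (insert x B)"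
    then obtain c where "z - scale c x \<in> span B" unfolding span_insert by auto
    then show "z \<in> ?f ` (UNIV \<times> span B)"
      by (intro image_eqI[of _ _ "(c, z - scale c x)"]) auto
  next
    fix z assume "z \<in> ?f ` (UNIV \<times> span B)"
    then obtain c y where "z = scale c x + y" "y \<in> span B" by auto
    then show "z \<in> span (insert x B)" unfolding span_insert by (auto intro!: exI[of _ c])
  qed
  have "inj_on ?f (UNIV \<times> span B)"
  proof (rule inj_onI, clarify)
    fix c y c' y'
    assume y: "y \<in> span B" "y' \<in> span B" and e: "scale c x + y = scale c' x + y'"
    have "scale (c - c') x = y' - y" using e by (simp add: scale_left_diff_distrib algebra_simps)
    then have "scale (c - c') x \<in> span B" using y by (simp add: span_diff)
    then have "scale (inverse (c - c')) (scale (c - c') x) \<in> span B" by (rule span_scale)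
    then have "c = c'" using x by (cases "c = c'") auto
    then show "c = c' \<and> y = y'" using e by simp
  qed
  then show ?case using insert B by (simp add: im card_image card_cartesian_product)
qed

lemma card_subspace:
  assumes "subspace S"
  shows "card S = CARD('a) ^ dim S"
proof -
  obtain B where "B \<subseteq> S" "independent B" "S \<subseteq> span B" "card B = dim S"
    using basis_exists[of S] by blast
  moreover from this have "span B = S" using assms span_subspace by blast
  ultimately show ?thesis using card_span_independent[of B] finiteI_independent by auto
qed

lemma finite_space: "finite (UNIV :: 'b set)"
  using card_span_independent[OF finite_Basis independent_Basis] span_Basis by simp

lemma finite_vectors [simp]: "finite (A :: 'b set)"
  by (rule finite_subset[OF subset_UNIV finite_space])

lemma finite_families [simp]: "finite (\<A> :: 'b set set)"
proof -
  have "finite (Pow (UNIV :: 'b set))" by (simp only: finite_Pow_iff finite_space)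
  then show ?thesis by (rule rev_finite_subset) auto
qed

lemma card_subspace_real:
  assumes "subspace S" shows "real (card S) = q ^ dim S"
  using card_subspace[OF assms] by (simp add: q_eq)

lemma dim_span_insert:
  assumes "subspace E" "x \<notin> E"
  shows "dim (span (insert x E)) = Suc (dim E)"
  using assms by (simp add: dim_insert span_eq_iff[THEN iffD2])

lemma span_insert_subset_iff:
  assumes "subspace F"
  shows "span (insert x E) \<subseteq> F \<longleftrightarrow> x \<in> F \<and> E \<subseteq> F"
  using assms span_superset[of "insert x E"] span_minimal[of "insert x E" F] by blast

lemma card_Diff_subspace:
  assumes "subspace E" "subspace F" "E \<subseteq> F"
  shows "real (card (F - E)) = q ^ dim F - q ^ dim E"
  using assms card_mono[of F E] by (simp add: card_Diff_subset of_nat_diff card_subspace_real)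

lemma members_containing_insert:
  assumes "\<A> \<subseteq> subspaces_of_dim scale k"
  shows "{F \<in> {F \<in> \<A>. E \<subseteq> F}. x \<in> F} = {F \<in> \<A>. span (insert x E) \<subseteq> F}"
proof -
  have "span (insert x E) \<subseteq> F \<longleftrightarrow> x \<in> F \<and> E \<subseteq> F" if "F \<in> \<A>" for F
    using assms that by (intro span_insert_subset_iff) (auto simp: subspaces_of_dim_def)
  then show ?thesis by auto
qed

section \<open>Upper bounds on degrees\<close>

text \<open>Counts pairs of a member \<open>F\<close> through \<open>E\<close> and a vector of
  \<open>F - E\<close>; each such vector enlarges \<open>E\<close> by one dimension. At dimension
  \<open>k\<close> only \<open>E\<close> itself can remain.\<close>

lemma degree_le_star_size:
  assumes "\<A> \<subseteq> subspaces_of_dim scale k" "subspace E" "dim E \<le> k"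
  shows "real (degree_of \<A> E) \<le> star_size q n k (dim E)"
  using assms(2,3)
proof (induction "k - dim E" arbitrary: E)
  case 0
  have "F = E" if "F \<in> \<A>" "E \<subseteq> F" for F
  proof (rule subspace_dim_equal[symmetric])
    have "subspace F" "dim F = k" using assms(1) that by (auto simp: subspaces_of_dim_def)
    then show "subspace F" "dim F \<le> dim E" using 0 by auto
  qed (use 0 that in auto)
  then have "{F \<in> \<A>. E \<subseteq> F} \<subseteq> {E}" by auto
  then have "card {F \<in> \<A>. E \<subseteq> F} \<le> card {E}" by (intro card_mono) auto
  then show ?case using 0 by (simp add: degree_of_def)
next
  case (Suc m)
  let ?D = "star_size q n k (Suc (dim E))"
  have "(q ^ k - q ^ dim E) * real (card {F \<in> \<A>. E \<subseteq> F}) \<le> real (card (UNIV - E)) * ?D"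
  proof (rule double_count_upper)
    fix F assume "F \<in> {F \<in> \<A>. E \<subseteq> F}"
    then show "q ^ k - q ^ dim E \<le> real (card (F \<inter> (UNIV - E)))"
      using assms(1) card_Diff_subspace[OF Suc.prems(1), of F]
      by (auto simp: subspaces_of_dim_def Diff_eq)
  next
    fix x assume "x \<in> UNIV - E"
    then have "dim (span (insert x E)) = Suc (dim E)" using Suc.prems dim_span_insert by blast
    then show "real (card {F \<in> {F \<in> \<A>. E \<subseteq> F}. x \<in> F}) \<le> ?D"
      using Suc.hyps(1)[of "span (insert x E)"] Suc.hyps(2)
      unfolding members_containing_insert[OF assms(1)] degree_of_def by simp
  qed auto
  moreover have "real (card (UNIV - E)) = q ^ n - q ^ dim E"
    using card_Diff_subspace[OF Suc.prems(1), of UNIV] by simp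
  moreover have "q ^ k - q ^ dim E > 0" using Suc.hyps(2) q_gt_1 by simp
  ultimately have "real (degree_of \<A> E) \<le> (q ^ n - q ^ dim E) * ?D / (q ^ k - q ^ dim E)"
    by (simp add: degree_of_def pos_le_divide_eq mult.commute)
  then show ?case using Suc.hyps(2) by (simp add: star_size_Suc)
qed

lemma meets_commute: "meets A B \<longleftrightarrow> meets B A"
  by (auto simp: meets_def)

lemma card_Int_ge_if_meets:
  assumes "subspace A" "subspace B" "meets A B"
  shows "q - 1 \<le> real (card (A \<inter> (B - {0})))"
proof -
  obtain v where v: "v \<in> A" "v \<in> B" "v \<noteq> 0" using assms(3) by (auto simp: meets_def)
  have s: "span {v} \<subseteq> A \<inter> B" using v assms by (simp add: span_minimal)
  have "q - 1 = real (card (span {v} - {0}))"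
    using card_Diff_subspace[of "{0}" "span {v}"] v span_zero by (simp add: dim_insert)
  also have "\<dots> \<le> real (card (A \<inter> (B - {0})))"
    using s by (intro of_nat_mono card_mono) auto
  finally show ?thesis .
qed

text \<open>Members containing \<open>E\<close> also meet some \<open>G\<close> that misses \<open>E\<close>, so \<open>E\<close> can be enlarged by a vector
  of \<open>G\<close>; this is repeated until the dimension \<open>s\<close> is reached.\<close>

lemma degree_le_chain:
  assumes \<A>: "\<A> \<subseteq> subspaces_of_dim scale k" and "s \<le> k" "k \<le> n"
    and miss: "\<And>E F. subspace E \<Longrightarrow> E0 \<subseteq> E \<Longrightarrow> F \<in> \<A> \<Longrightarrow> E \<subseteq> F \<Longrightarrow> dim E < s \<Longrightarrow>
      \<exists>G \<in> subspaces_of_dim scale k. \<not> meets E G \<and> (\<forall>F\<in>\<A>. meets F G)"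
    and "subspace E" "E0 \<subseteq> E" "dim E \<le> s"
  shows "(q - 1) ^ (s - dim E) * real (degree_of \<A> E) \<le> (q ^ k - 1) ^ (s - dim E) * star_size q n k s"
  using assms(5-7)
proof (induction "s - dim E" arbitrary: E)
  case 0
  then show ?case using degree_le_star_size[OF \<A>, of E] assms(2) by simp
next
  case (Suc m)
  \<comment> \<open>\<open>miss\<close> needs a member through \<open>E\<close>; without one the
    degree is 0 and the bound trivial.\<close>
  show ?case
  proof (cases "{F \<in> \<A>. E \<subseteq> F} = {}")
    case True
    then have "degree_of \<A> E = 0" unfolding degree_of_def by (metis card.empty)
    then show ?thesis
      using q_gt_1 star_size_pos[OF q_gt_1 \<open>k \<le> n\<close>, of s] by simp
  next
    case False
    then obtain F where F: "F \<in> \<A>" "E \<subseteq> F" by auto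
    have "dim E < s" using Suc.hyps(2) by linarith
    with F obtain G where G: "G \<in> subspaces_of_dim scale k" "\<not> meets E G" "\<forall>F\<in>\<A>. meets F G"
      using miss[of E F] Suc.prems by auto
    let ?D = "(q ^ k - 1) ^ m * star_size q n k s / (q - 1) ^ m"
    have sG: "subspace G" "dim G = k" using G by (auto simp: subspaces_of_dim_def)
    have "(q - 1) * real (card {F \<in> \<A>. E \<subseteq> F}) \<le> real (card (G - {0})) * ?D"
    proof (rule double_count_upper)
      fix F assume "F \<in> {F \<in> \<A>. E \<subseteq> F}"
      then show "q - 1 \<le> real (card (F \<inter> (G - {0})))"
        using G \<A> sG by (intro card_Int_ge_if_meets) (auto simp: subspaces_of_dim_def)
    next
      fix x assume x: "x \<in> G - {0}"
      then have "x \<notin> E" using G(2) by (auto simp: meets_def)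
      then have d: "dim (span (insert x E)) = Suc (dim E)" using Suc.prems dim_span_insert by simp
      have "E0 \<subseteq> span (insert x E)" using Suc.prems span_superset[of "insert x E"] by auto
      moreover have "m = s - Suc (dim E)" "Suc (dim E) \<le> s" using Suc.hyps(2) by linarith+
      ultimately have "(q - 1) ^ m * real (degree_of \<A> (span (insert x E))) \<le> (q ^ k - 1) ^ m * star_size q n k s"
        using Suc.hyps(1)[of "span (insert x E)"] d by simp
      then show "real (card {F \<in> {F \<in> \<A>. E \<subseteq> F}. x \<in> F}) \<le> ?D"
        using q_gt_1 unfolding members_containing_insert[OF \<A>] degree_of_def
        by (simp add: pos_le_divide_eq mult.commute)
    qed auto
    moreover have "real (card (G - {0})) = q ^ k - 1"
      using card_Diff_subspace[of "{0}" G] sG subspace_0[of G] by (simp add: dim_insert)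
    ultimately have "(q - 1) * real (degree_of \<A> E) \<le> (q ^ k - 1) * ?D" by (simp add: degree_of_def)
    then have "(q - 1) * real (degree_of \<A> E) * (q - 1) ^ m \<le> (q ^ k - 1) * ((q ^ k - 1) ^ m * star_size q n k s)"
      using q_gt_1 by (simp add: pos_le_divide_eq)
    then show ?thesis unfolding Suc.hyps(2)[symmetric] by (simp add: ac_simps)
  qed
qed

section \<open>Lower bounds on degrees when all members meet \<open>W\<close>\<close>

lemma card_span_Un_le:
  assumes "subspace S" "subspace W"
  shows "real (card (span (S \<union> W))) \<le> q ^ (dim W + dim S)"
proof -
  have "span (S \<union> W) = (\<lambda>(x, y). x + y) ` (S \<times> W)"
    unfolding span_Un using assms by (auto simp: span_eq_iff[THEN iffD2])
  then have "card (span (S \<union> W)) \<le> card (S \<times> W)"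
    by (metis card_image_le finite_cartesian_product finite_vectors)
  then have "real (card (span (S \<union> W))) \<le> real (card S * card W)"
    by (simp only: card_cartesian_product of_nat_le_iff)
  then show ?thesis using assms by (simp add: card_subspace_real power_add mult.commute)
qed

text \<open>If every member meets \<open>W\<close>, only few of the ways to enlarge a subspace that misses \<open>W\<close> to
  a larger one that still misses \<open>W\<close> stay inside a given member.\<close>

lemma degree_ge_if_all_meet:
  assumes \<A>: "\<A> \<subseteq> subspaces_of_dim scale k" and W: "subspace W" "\<And>F. F \<in> \<A> \<Longrightarrow> meets F W"
    and "d < k" "dim W + d \<le> n" "m \<ge> 0"
    and m: "\<And>S. S \<in> subspaces_of_dim scale d \<Longrightarrow> m \<le> real (degree_of \<A> S)"
    and "subspace S" "\<not> meets S W" "dim S \<le> d"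
  shows "m * (\<Prod>i=dim S..<d. (q ^ n - q ^ (dim W + i)) / (q ^ k - q ^ Suc i)) \<le> real (degree_of \<A> S)"
  using assms(8-10)
proof (induction "d - dim S" arbitrary: S)
  case 0
  then show ?case using m[of S] by (simp add: subspaces_of_dim_def)
next
  case (Suc l)
  define P where "P j = m * (\<Prod>i=j..<d. (q ^ n - q ^ (dim W + i)) / (q ^ k - q ^ Suc i))" for j
  let ?X = "UNIV - span (S \<union> W)"
  have lt: "dim S < d" and l: "l = d - Suc (dim S)" using Suc.hyps(2) by linarith+
  have P0: "P j \<ge> 0" for j
    unfolding P_def using assms(4-6) q_gt_1
    by (intro mult_nonneg_nonneg prod_nonneg) (auto intro!: divide_nonneg_nonneg power_increasing simp del: power_Suc)
  have "real (card ?X) * P (Suc (dim S)) \<le> (q ^ k - q ^ Suc (dim S)) * real (card {F \<in> \<A>. S \<subseteq> F})"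
  proof (rule double_count_lower)
    fix F assume F: "F \<in> {F \<in> \<A>. S \<subseteq> F}"
    then have sF: "subspace F" "dim F = k" using \<A> by (auto simp: subspaces_of_dim_def)
    \<comment> \<open>\<open>F\<close> shares with \<open>W\<close> a vector \<open>v\<close>
      outside \<open>S\<close>, so all of \<open>span (insert v S)\<close> is lost to
      \<open>span (S \<union> W)\<close>.\<close>
    obtain v where v: "v \<in> F" "v \<in> W" "v \<noteq> 0" using W(2) F by (auto simp: meets_def)
    then have "v \<notin> S" using Suc.prems(2) by (auto simp: meets_def)
    have "insert v S \<subseteq> S \<union> W" using v by auto
    then have "span (insert v S) \<subseteq> span (S \<union> W)" by (rule span_mono)
    then have "card (F \<inter> ?X) \<le> card (F - span (insert v S))"
      by (intro card_mono) auto
    moreover have "span (insert v S) \<subseteq> F" using F v sF by (simp add: span_insert_subset_iff)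
    ultimately show "real (card (F \<inter> ?X)) \<le> q ^ k - q ^ Suc (dim S)"
      using card_Diff_subspace[of "span (insert v S)" F] sF dim_span_insert[OF Suc.prems(1) \<open>v \<notin> S\<close>]
      by simp
  next
    fix x assume x: "x \<in> ?X"
    have xS: "x \<notin> S" using x span_superset[of "S \<union> W"] by auto
    \<comment> \<open>Vectors inside \<open>span (S \<union> W)\<close> are left out precisely so
      that the enlarged subspace still misses \<open>W\<close>.\<close>
    have "\<not> meets (span (insert x S)) W"
    proof
      assume "meets (span (insert x S)) W"
      then obtain w c where w: "w \<in> W" "w \<noteq> 0" "w - scale c x \<in> S"
        using Suc.prems(1) by (auto simp: meets_def span_insert span_eq_iff[THEN iffD2])
      show False
      proof (cases "c = 0")
        case True
        then show False using w Suc.prems(2) by (auto simp: meets_def)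
      next
        case False
        have "w - (w - scale c x) \<in> span (S \<union> W)" using w by (intro span_diff span_base) auto
        then have "scale c x \<in> span (S \<union> W)" by simp
        then have "scale (inverse c) (scale c x) \<in> span (S \<union> W)" by (rule span_scale)
        then have "x \<in> span (S \<union> W)" using False by simp
        then show False using x by simp
      qed
    qed
    then show "P (Suc (dim S)) \<le> real (card {F \<in> {F \<in> \<A>. S \<subseteq> F}. x \<in> F})"
      using Suc.hyps(1)[of "span (insert x S)"] dim_span_insert[OF Suc.prems(1) xS] l lt
      unfolding members_containing_insert[OF \<A>] degree_of_def P_def by simp
  qed auto
  moreover have "q ^ n - q ^ (dim W + dim S) \<le> real (card ?X)"
    using card_span_Un_le[OF Suc.prems(1) W(1)] card_Diff_subspace[of "span (S \<union> W)" UNIV]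
      card_subspace_real[of "span (S \<union> W)"] by simp
  ultimately have "(q ^ n - q ^ (dim W + dim S)) * P (Suc (dim S)) \<le>
      (q ^ k - q ^ Suc (dim S)) * real (degree_of \<A> S)"
    using mult_right_mono[OF _ P0[of "Suc (dim S)"]] unfolding degree_of_def by (meson order_trans)
  moreover have "q ^ k - q ^ Suc (dim S) > 0"
    using lt assms(4) q_gt_1 power_strict_increasing[of "Suc (dim S)" k q] by simp
  ultimately have "(q ^ n - q ^ (dim W + dim S)) * P (Suc (dim S)) / (q ^ k - q ^ Suc (dim S)) \<le>
      real (degree_of \<A> S)"
    by (simp only: pos_divide_le_eq mult.commute)
  moreover have "P (dim S) = (q ^ n - q ^ (dim W + dim S)) * P (Suc (dim S)) / (q ^ k - q ^ Suc (dim S))"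
    unfolding P_def using lt by (simp add: prod.atLeast_Suc_lessThan)
  ultimately show ?case by (simp add: P_def)
qed

text \<open>The case \<open>S = {0}\<close>, which misses \<open>W\<close> and lies in every
  member.\<close>

lemma card_ge_if_all_meet:
  assumes "\<A> \<subseteq> subspaces_of_dim scale k" "subspace W" "\<And>F. F \<in> \<A> \<Longrightarrow> meets F W"
    and "d < k" "dim W + d \<le> n" "m \<ge> 0"
    and "\<And>S. S \<in> subspaces_of_dim scale d \<Longrightarrow> m \<le> real (degree_of \<A> S)"
  shows "m * (\<Prod>i<d. (q ^ n - q ^ (dim W + i)) / (q ^ k - q ^ Suc i)) \<le> real (card \<A>)"
proof -
  have "{F \<in> \<A>. {0} \<subseteq> F} = \<A>"
    using assms(1) subspace_0 by (auto simp: subspaces_of_dim_def)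
  then have "degree_of \<A> {0} = card \<A>" by (simp add: degree_of_def)
  moreover have "\<not> meets {0} W" by (simp add: meets_def)
  ultimately show ?thesis
    using degree_ge_if_all_meet[OF assms, of "{0}"] by (simp add: lessThan_atLeast0)
qed

section \<open>Covering numbers\<close>

text \<open>The covering number is the least dimension of a subspace that meets all members. This
  form directly hands a missed member to the chain argument.\<close>

definition covering_number_ge :: "'b set set \<Rightarrow> nat \<Rightarrow> bool" where
  "covering_number_ge \<F> t \<longleftrightarrow> (\<forall>E. subspace E \<longrightarrow> dim E < t \<longrightarrow> (\<exists>G\<in>\<F>. \<not> meets E G))"

text \<open>The chain starts at \<open>span {v}\<close>, so \<open>t - 1\<close> steps remain; the
  member missed by a small \<open>E\<close> meets all members because the family is
  intersecting.\<close>

lemma degree_vector_le: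
  assumes "\<F> \<subseteq> subspaces_of_dim scale k" "\<And>F G. F \<in> \<F> \<Longrightarrow> G \<in> \<F> \<Longrightarrow> meets F G"
    and "covering_number_ge \<F> t" "1 \<le> t" "t \<le> k" "k \<le> n" "v \<noteq> 0"
  shows "(q - 1) ^ (t - 1) * real (card {F \<in> \<F>. v \<in> F}) \<le> (q ^ k - 1) ^ (t - 1) * star_size q n k t"
proof -
  have "(q - 1) ^ (t - dim (span {v})) * real (degree_of \<F> (span {v})) \<le>
      (q ^ k - 1) ^ (t - dim (span {v})) * star_size q n k t"
  proof (rule degree_le_chain[OF assms(1,5,6), where ?E0.0 = "{}"])
    fix E F assume "subspace E" "dim E < t"
    then show "\<exists>G\<in>subspaces_of_dim scale k. \<not> meets E G \<and> (\<forall>F\<in>\<F>. meets F G)"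
      using assms(1-3) unfolding covering_number_ge_def by blast
  qed (use assms in auto)
  moreover have "degree_of \<F> (span {v}) = card {F \<in> \<F>. v \<in> F}"
    using members_containing_insert[OF assms(1), of "{}" v] by (simp add: degree_of_def)
  ultimately show ?thesis using assms(7) by simp
qed

text \<open>Each member holds at least \<open>q - 1\<close> of the \<open>q ^ t - 1\<close> nonzero
  vectors of \<open>W\<close>, whose degrees are bounded by \<open>degree_vector_le\<close>.\<close>

lemma card_le_if_covered:
  assumes "\<F> \<subseteq> subspaces_of_dim scale k" "\<And>F G. F \<in> \<F> \<Longrightarrow> G \<in> \<F> \<Longrightarrow> meets F G"
    and "covering_number_ge \<F> t" "1 \<le> t" "t \<le> k" "k \<le> n"
    and W: "subspace W" "dim W = t" "\<And>F. F \<in> \<F> \<Longrightarrow> meets F W"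
  shows "(q - 1) ^ t * real (card \<F>) \<le> (q ^ t - 1) * (q ^ k - 1) ^ (t - 1) * star_size q n k t"
proof -
  let ?D = "(q ^ k - 1) ^ (t - 1) * star_size q n k t / (q - 1) ^ (t - 1)"
  have "(q - 1) * real (card \<F>) \<le> real (card (W - {0})) * ?D"
  proof (rule double_count_upper)
    fix F assume "F \<in> \<F>"
    then show "q - 1 \<le> real (card (F \<inter> (W - {0})))"
      using assms(1) W by (intro card_Int_ge_if_meets) (auto simp: subspaces_of_dim_def)
  next
    fix x assume "x \<in> W - {0}"
    then show "real (card {F \<in> \<F>. x \<in> F}) \<le> ?D"
      using degree_vector_le[OF assms(1-6), of x] q_gt_1 by (simp add: pos_le_divide_eq mult.commute)
  qed auto
  moreover have "real (card (W - {0})) = q ^ t - 1"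
    using card_Diff_subspace[of "{0}" W] W subspace_0[of W] by simp
  ultimately have "(q - 1) * real (card \<F>) * (q - 1) ^ (t - 1) \<le>
      (q ^ t - 1) * ((q ^ k - 1) ^ (t - 1) * star_size q n k t)"
    using q_gt_1 by (simp add: pos_le_divide_eq)
  moreover have "(q - 1) ^ t = (q - 1) * (q - 1) ^ (t - 1)"
    using assms(4) by (simp flip: power_Suc)
  ultimately show ?thesis by (simp add: ac_simps)
qed

section \<open>Cross-intersecting families at two points\<close>

definition exclusive :: "'b set set \<Rightarrow> 'b \<Rightarrow> 'b \<Rightarrow> 'b set set" where
  "exclusive \<F> p r = {F \<in> \<F>. p \<in> F \<and> r \<notin> F}"

text \<open>For members through \<open>p\<close> this is a cover in the quotient by
  \<open>span {p}\<close>: the image of \<open>R\<close> meets the image of every member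
  nontrivially. So \<open>dim R = Suc a\<close> stands for a cover of dimension
  \<open>a\<close>.\<close>

definition covers_beyond :: "'b \<Rightarrow> 'b set set \<Rightarrow> 'b set \<Rightarrow> bool" where
  "covers_beyond p \<A> R \<longleftrightarrow> subspace R \<and> p \<in> R \<and> (\<forall>F\<in>\<A>. \<exists>v\<in>F \<inter> R. v \<notin> span {p})"

text \<open>Here \<open>a\<close> limits the 2-dimensional starting subspaces through
  \<open>p\<close>, and \<open>b\<close> prolongs the chain: if \<open>dim E < b\<close>, then
  \<open>span (insert r E)\<close> is too small to cover the opposite family, so one of its members
  misses \<open>E\<close>. Below \<open>t\<close> the covering number of \<open>\<F>\<close>
  provides the missed member.\<close>

lemma card_exclusive_le:
  assumes \<F>: "\<F> \<subseteq> subspaces_of_dim scale k" and int: "\<And>F G. F \<in> \<F> \<Longrightarrow> G \<in> \<F> \<Longrightarrow> meets F G"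
    and t: "covering_number_ge \<F> t" and pr: "p \<noteq> 0" "r \<noteq> 0"
    and R: "covers_beyond p (exclusive \<F> p r) R" "dim R = Suc a"
    and b: "\<And>R. covers_beyond r (exclusive \<F> r p) R \<Longrightarrow> Suc b \<le> dim R"
    and s: "s = max b t" "2 \<le> s" "s \<le> k" "k \<le> n"
  shows "(q - 1) ^ (s - 1) * real (card (exclusive \<F> p r)) \<le>
    (q ^ a - 1) * (q ^ k - 1) ^ (s - 2) * star_size q n k s"
proof -
  let ?A = "exclusive \<F> p r" and ?B = "exclusive \<F> r p"
  let ?D = "(q ^ k - 1) ^ (s - 2) * star_size q n k s / (q - 1) ^ (s - 2)"
  have A: "?A \<subseteq> subspaces_of_dim scale k" using \<F> by (auto simp: exclusive_def)
  have sR: "subspace R" "p \<in> R" using R by (auto simp: covers_beyond_def)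
  have dp: "dim (span {p}) = 1" using pr by simp
  have miss: "\<exists>G \<in> subspaces_of_dim scale k. \<not> meets E G \<and> (\<forall>F\<in>?A. meets F G)"
    if E: "subspace E" "span {p} \<subseteq> E" "F \<in> ?A" "E \<subseteq> F" "dim E < s" for E F
  proof -
    have "\<exists>G\<in>\<F>. \<not> meets E G"
    proof (cases "dim E < t")
      case True
      then show ?thesis using t E(1) by (auto simp: covering_number_ge_def)
    next
      case False
      then have "dim E < b" using E(5) s(1) by auto
      \<comment> \<open>\<open>E\<close> lies in a member that avoids \<open>r\<close>; adjoining
        \<open>r\<close> gives dimension at most \<open>b\<close>, one short of a cover.\<close>
      have rE: "r \<notin> E" using E(3,4) by (auto simp: exclusive_def)
      have "\<not> covers_beyond r ?B (span (insert r E))"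
        using b[of "span (insert r E)"] dim_span_insert[OF E(1) rE] \<open>dim E < b\<close> by auto
      then obtain G where G: "G \<in> ?B" "\<And>v. v \<in> G \<Longrightarrow> v \<in> span (insert r E) \<Longrightarrow> v \<in> span {r}"
        using span_base[of r "insert r E"] by (auto simp: covers_beyond_def)
      have "\<not> meets E G"
      proof
        assume "meets E G"
        then obtain v where v: "v \<in> E" "v \<in> G" "v \<noteq> 0" by (auto simp: meets_def)
        then have "v \<in> span {r}" using G(2) span_base[of v "insert r E"] by auto
        then obtain c where c: "v = scale c r" by (auto simp: span_singleton)
        then have "c \<noteq> 0" using v(3) by auto
        have "scale (inverse c) v \<in> E" using E(1) v(1) by (rule subspace_scale)
        then show False using rE c \<open>c \<noteq> 0\<close> by simp
      qed
      then show ?thesis using G(1) by (auto simp: exclusive_def)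
    qed
    then show ?thesis using \<F> int by (auto simp: exclusive_def)
  qed
  \<comment> \<open>A 2-dimensional subspace through \<open>p\<close> has \<open>q ^ 2 - q\<close>
    vectors outside \<open>span {p}\<close>; its factor \<open>q\<close> later cancels against the
    one in \<open>card (R - span {p})\<close>.\<close>
  have "(q ^ 2 - q) * real (card ?A) \<le> real (card (R - span {p})) * ?D"
  proof (rule double_count_upper)
    fix F assume F: "F \<in> ?A"
    then have sF: "subspace F" "p \<in> F" using A by (auto simp: exclusive_def subspaces_of_dim_def)
    obtain v where v: "v \<in> F" "v \<in> R" "v \<notin> span {p}"
      using R(1) F by (auto simp: covers_beyond_def)
    let ?E = "span (insert v (span {p}))"
    have "?E \<subseteq> F" "?E \<subseteq> R" using v sF sR by (auto simp: span_insert_subset_iff span_minimal)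
    then have "card (?E - span {p}) \<le> card (F \<inter> (R - span {p}))" by (intro card_mono) auto
    moreover have "span {p} \<subseteq> ?E" using span_superset[of "insert v (span {p})"] by auto
    then have "real (card (?E - span {p})) = q ^ 2 - q"
      using card_Diff_subspace[of "span {p}" ?E] dim_span_insert[OF _ v(3)] dp
      by (simp add: numeral_2_eq_2)
    ultimately show "q ^ 2 - q \<le> real (card (F \<inter> (R - span {p})))" by linarith
  next
    fix x assume x: "x \<in> R - span {p}"
    let ?E = "span (insert x (span {p}))"
    have "(q - 1) ^ (s - dim ?E) * real (degree_of ?A ?E) \<le> (q ^ k - 1) ^ (s - dim ?E) * star_size q n k s"
      using span_superset[of "insert x (span {p})"] s x dp dim_span_insert[of "span {p}" x]
      by (intro degree_le_chain[OF A s(3,4) miss]) auto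
    moreover have "dim ?E = 2" using dim_span_insert[of "span {p}" x] x dp by simp
    moreover have "{F \<in> ?A. x \<in> F} = {F \<in> ?A. ?E \<subseteq> F}"
    proof -
      have "{F \<in> ?A. span {p} \<subseteq> F} = ?A"
        using members_containing_insert[OF A, of "{}" p] by (auto simp: exclusive_def)
      then show ?thesis using members_containing_insert[OF A, of "span {p}" x] by simp
    qed
    ultimately show "real (card {F \<in> ?A. x \<in> F}) \<le> ?D"
      using q_gt_1 by (simp add: degree_of_def pos_le_divide_eq mult.commute)
  qed auto
  moreover have "real (card (R - span {p})) = q * (q ^ a - 1)"
    using card_Diff_subspace[of "span {p}" R] sR R(2) dp
    by (simp add: span_minimal right_diff_distrib)
  ultimately have "q * ((q - 1) * real (card ?A)) \<le> q * ((q ^ a - 1) * ?D)"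
    by (simp add: power2_eq_square algebra_simps)
  then have "(q - 1) * real (card ?A) \<le> (q ^ a - 1) * ?D"
    using q_gt_1 by (simp only: mult_le_cancel_left_pos)
  then have "(q - 1) * real (card ?A) * (q - 1) ^ (s - 2) \<le> (q ^ a - 1) * ((q ^ k - 1) ^ (s - 2) * star_size q n k s)"
    using q_gt_1 by (simp add: pos_le_divide_eq)
  moreover have "(q - 1) ^ (s - 1) = (q - 1) * (q - 1) ^ (s - 2)"
    using s(2) by (simp flip: power_Suc add: Suc_diff_Suc numeral_2_eq_2)
  ultimately show ?thesis by (simp add: ac_simps)
qed

text \<open>A vector shared by \<open>F\<close> and \<open>G\<close> is no multiple of
  \<open>p\<close>, since \<open>p\<close> is not in \<open>G\<close>. Hence the covering number
  beyond \<open>p\<close> is at most \<open>k\<close> once the opposite family is nonempty.\<close>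

lemma covers_beyond_span_insert:
  assumes "\<F> \<subseteq> subspaces_of_dim scale k" "\<And>F G. F \<in> \<F> \<Longrightarrow> G \<in> \<F> \<Longrightarrow> meets F G"
    and G: "G \<in> exclusive \<F> r p" and "p \<noteq> 0"
  shows "covers_beyond p (exclusive \<F> p r) (span (insert p G))" "dim (span (insert p G)) = Suc k"
proof -
  have sG: "subspace G" "dim G = k" "p \<notin> G"
    using assms by (auto simp: exclusive_def subspaces_of_dim_def)
  then show "dim (span (insert p G)) = Suc k" using dim_span_insert by blast
  have "\<exists>v\<in>F \<inter> span (insert p G). v \<notin> span {p}" if "F \<in> exclusive \<F> p r" for F
  proof -
    have "meets F G" using assms that by (auto simp: exclusive_def)
    then obtain v where v: "v \<in> F" "v \<in> G" "v \<noteq> 0" by (auto simp: meets_def)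
    have "v \<notin> span {p}"
    proof
      assume "v \<in> span {p}"
      then obtain c where c: "v = scale c p" by (auto simp: span_singleton)
      then have "c \<noteq> 0" using v(3) by auto
      have "scale (inverse c) v \<in> G" using sG(1) v(2) by (rule subspace_scale)
      then show False using sG(3) c \<open>c \<noteq> 0\<close> by simp
    qed
    then show ?thesis using v span_base[of v "insert p G"] by auto
  qed
  then show "covers_beyond p (exclusive \<F> p r) (span (insert p G))"
    using span_base[of p "insert p G"] by (auto simp: covers_beyond_def)
qed

lemma exists_min_covers_beyond:
  assumes "covers_beyond p \<A> R0" "p \<noteq> 0" "dim R0 = Suc k"
  shows "\<exists>R a. covers_beyond p \<A> R \<and> dim R = Suc a \<and> a \<le> k \<and>
    (\<forall>R'. covers_beyond p \<A> R' \<longrightarrow> Suc a \<le> dim R')"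
proof -
  obtain R where R: "covers_beyond p \<A> R" "\<And>R'. covers_beyond p \<A> R' \<Longrightarrow> dim R \<le> dim R'"
    using ex_has_least_nat[of "covers_beyond p \<A>" R0 dim] assms(1) by blast
  have "dim {p} \<le> dim R" using R(1) by (intro dim_subset) (auto simp: covers_beyond_def)
  moreover have "dim {p} = 1" using assms(2) by simp
  ultimately have "dim R \<noteq> 0" by linarith
  then obtain a where a: "dim R = Suc a" using not0_implies_Suc by blast
  moreover have "dim R \<le> Suc k" using R(2)[OF assms(1)] assms(3) by simp
  ultimately show ?thesis using R by (intro exI[of _ R] exI[of _ a]) auto
qed

text \<open>With \<open>s = max b t\<close>, the assumption \<open>a \<le> b\<close> allows
  \<open>q ^ a\<close> to be raised to \<open>q ^ s\<close>.\<close>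

lemma exclusive_bound_if_le:
  assumes \<F>: "\<F> \<subseteq> subspaces_of_dim scale k" "\<And>F G. F \<in> \<F> \<Longrightarrow> G \<in> \<F> \<Longrightarrow> meets F G"
    and t: "covering_number_ge \<F> t" and pr: "p \<noteq> 0" "r \<noteq> 0"
    and R: "covers_beyond p (exclusive \<F> p r) R" "dim R = Suc a"
    and b: "\<And>R. covers_beyond r (exclusive \<F> r p) R \<Longrightarrow> Suc b \<le> dim R"
    and "a \<le> b" "b \<le> k" "2 \<le> t" "t \<le> k" "k \<le> n"
  shows "\<exists>s. t \<le> s \<and> s \<le> k \<and> (q - 1) ^ (s - 1) * real (card (exclusive \<F> p r)) \<le>
    (q ^ s - 1) * (q ^ k - 1) ^ (s - 2) * star_size q n k s"
proof (intro exI conjI)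
  let ?s = "max b t"
  have "(q - 1) ^ (?s - 1) * real (card (exclusive \<F> p r)) \<le>
      (q ^ a - 1) * (q ^ k - 1) ^ (?s - 2) * star_size q n k ?s"
    using assms by (intro card_exclusive_le[OF \<F> t pr R b]) auto
  also have "\<dots> \<le> (q ^ ?s - 1) * (q ^ k - 1) ^ (?s - 2) * star_size q n k ?s"
    using q_gt_1 less_imp_le[OF star_size_pos[OF q_gt_1 \<open>k \<le> n\<close>]] assms
    by (intro mult_right_mono) (auto intro!: power_increasing)
  finally show "(q - 1) ^ (?s - 1) * real (card (exclusive \<F> p r)) \<le>
      (q ^ ?s - 1) * (q ^ k - 1) ^ (?s - 2) * star_size q n k ?s" .
qed (use assms in auto)

text \<open>The side with the smaller covering number is bounded through the covering number of the
  other side. If that side is the larger family, the smaller one inherits the bound.\<close>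

lemma exclusive_min_bound:
  assumes \<F>: "\<F> \<subseteq> subspaces_of_dim scale k" "\<And>F G. F \<in> \<F> \<Longrightarrow> G \<in> \<F> \<Longrightarrow> meets F G"
    and t: "covering_number_ge \<F> t" and pr: "p \<noteq> 0" "r \<noteq> 0"
    and le: "card (exclusive \<F> p r) \<le> card (exclusive \<F> r p)"
    and tk: "2 \<le> t" "t \<le> k" "k \<le> n"
  shows "\<exists>s. t \<le> s \<and> s \<le> k \<and> (q - 1) ^ (s - 1) * real (card (exclusive \<F> p r)) \<le>
    (q ^ s - 1) * (q ^ k - 1) ^ (s - 2) * star_size q n k s"
proof (cases "exclusive \<F> p r = {}")
  case True
  \<comment> \<open>Covers come from members of the opposite family, so emptiness is treated apart;
    \<open>s = t\<close> will do.\<close>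
  then show ?thesis
    using q_gt_1 less_imp_le[OF star_size_pos[OF q_gt_1 \<open>k \<le> n\<close>]] tk
    by (intro exI[of _ t]) auto
next
  case False
  then have "card (exclusive \<F> p r) \<noteq> 0" by simp
  then have "exclusive \<F> r p \<noteq> {}" using le by auto
  with False obtain F G where FG: "F \<in> exclusive \<F> p r" "G \<in> exclusive \<F> r p" by auto
  obtain R a where R: "covers_beyond p (exclusive \<F> p r) R" "dim R = Suc a" "a \<le> k"
    "\<And>R'. covers_beyond p (exclusive \<F> p r) R' \<Longrightarrow> Suc a \<le> dim R'"
    using exists_min_covers_beyond[OF covers_beyond_span_insert(1)[OF \<F> FG(2) pr(1)] pr(1)
        covers_beyond_span_insert(2)[OF \<F> FG(2) pr(1)]] by auto
  obtain Q b where Q: "covers_beyond r (exclusive \<F> r p) Q" "dim Q = Suc b" "b \<le> k"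
    "\<And>R'. covers_beyond r (exclusive \<F> r p) R' \<Longrightarrow> Suc b \<le> dim R'"
    using exists_min_covers_beyond[OF covers_beyond_span_insert(1)[OF \<F> FG(1) pr(2)] pr(2)
        covers_beyond_span_insert(2)[OF \<F> FG(1) pr(2)]] by auto
  show ?thesis
  proof (cases "a \<le> b")
    case True
    then show ?thesis using exclusive_bound_if_le[OF \<F> t pr R(1,2) Q(4)] Q(3) tk by blast
  next
    case False
    then obtain s where s: "t \<le> s" "s \<le> k" "(q - 1) ^ (s - 1) * real (card (exclusive \<F> r p)) \<le>
        (q ^ s - 1) * (q ^ k - 1) ^ (s - 2) * star_size q n k s"
      using exclusive_bound_if_le[OF \<F> t pr(2,1) Q(1,2) R(4)] R(3) tk by auto
    have "(q - 1) ^ (s - 1) * real (card (exclusive \<F> p r)) \<le>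
        (q - 1) ^ (s - 1) * real (card (exclusive \<F> r p))"
      using le q_gt_1 by (intro mult_left_mono) auto
    then show ?thesis using s by force
  qed
qed

section \<open>Size of the family for \<open>q = 2\<close>, \<open>n = 2 k + 1\<close>\<close>

text \<open>For \<open>q = 2\<close> nonzero vectors are points. A point \<open>r\<close> of
  \<open>W\<close> of maximal degree is charged with its full degree, every other point
  \<open>p\<close> only with the members avoiding \<open>r\<close>.\<close>

lemma binary_card_le:
  assumes \<F>: "\<F> \<subseteq> subspaces_of_dim scale k" "\<And>F G. F \<in> \<F> \<Longrightarrow> G \<in> \<F> \<Longrightarrow> meets F G"
    and t: "covering_number_ge \<F> t" "2 \<le> t" "t \<le> k" and q: "q = 2" and n: "n = 2 * k + 1"
    and W: "subspace W" "dim W = t" "\<And>F. F \<in> \<F> \<Longrightarrow> meets F W"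
  shows "real (card \<F>) \<le> loss k t * (2 / 2 ^ t + (2 ^ t - 2) * (2 / 2 ^ k)) * star_size q n k 1"
proof -
  let ?N = "star_size 2 (2 * k + 1) k 1" and ?deg = "\<lambda>v. card {F \<in> \<F>. v \<in> F}"
  have cW: "real (card (W - {0})) = 2 ^ t - 1"
    using card_Diff_subspace[of "{0}" W] W subspace_0[of W] q by simp
  have "(2::real) ^ t \<ge> 2 ^ 2" using t by (intro power_increasing) auto
  then have "W - {0} \<noteq> {}" using cW by force
  then have "Max (?deg ` (W - {0})) \<in> ?deg ` (W - {0})" by (intro Max_in) auto
  then obtain r where r0: "r \<in> W - {0}" "Max (?deg ` (W - {0})) = ?deg r" by blast
  have r: "r \<in> W" "r \<noteq> 0" "\<And>p. p \<in> W - {0} \<Longrightarrow> ?deg p \<le> ?deg r"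
    using r0 by (auto simp flip: r0(2))
  have excl: "real (card (exclusive \<F> p r)) \<le> 2 / 2 ^ k * loss k t * ?N" if p: "p \<in> W - {0, r}" for p
  proof -
    \<comment> \<open>Members through both points cancel, so maximality of \<open>r\<close> makes
      \<open>exclusive \<F> p r\<close> the smaller of the two families.\<close>
    have split: "?deg x = card (exclusive \<F> x y) + card {F \<in> \<F>. x \<in> F \<and> y \<in> F}" for x y
      unfolding exclusive_def
      by (subst card_Un_disjoint[symmetric]) (auto intro!: arg_cong[where f = card])
    have "{F \<in> \<F>. p \<in> F \<and> r \<in> F} = {F \<in> \<F>. r \<in> F \<and> p \<in> F}" by auto
    then have "card (exclusive \<F> p r) \<le> card (exclusive \<F> r p)"
      using split[of p r] split[of r p] r(3)[of p] p by auto
    then obtain s where "t \<le> s" "s \<le> k" "real (card (exclusive \<F> p r)) \<le>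
        (2 ^ s - 1) * (2 ^ k - 1) ^ (s - 2) * star_size 2 (2 * k + 1) k s"
      using exclusive_min_bound[OF \<F> t(1), of p r] p r(2) t q n by auto
    then show ?thesis using t by (intro binary_exclusive_bound) auto
  qed
  have dr: "real (?deg r) \<le> 2 / 2 ^ t * loss k t * ?N"
    using degree_vector_le[OF \<F> t(1), of r] binary_star_size_le[of t k] t r(2) q n by simp
  have "\<F> \<subseteq> {F \<in> \<F>. r \<in> F} \<union> (\<Union>p\<in>W - {0, r}. exclusive \<F> p r)"
    using W(3) by (force simp: meets_def exclusive_def)
  then have "card \<F> \<le> card ({F \<in> \<F>. r \<in> F} \<union> (\<Union>p\<in>W - {0, r}. exclusive \<F> p r))"
    by (intro card_mono) auto
  also have "\<dots> \<le> ?deg r + card (\<Union>p\<in>W - {0, r}. exclusive \<F> p r)" by (rule card_Un_le)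
  also have "\<dots> \<le> ?deg r + (\<Sum>p\<in>W - {0, r}. card (exclusive \<F> p r))"
    by (intro add_left_mono card_UN_le) auto
  finally have "real (card \<F>) \<le> real (?deg r) + (\<Sum>p\<in>W - {0, r}. real (card (exclusive \<F> p r)))"
    by (simp flip: of_nat_sum of_nat_add)
  also have "\<dots> \<le> 2 / 2 ^ t * loss k t * ?N + (\<Sum>p\<in>W - {0, r}. 2 / 2 ^ k * loss k t * ?N)"
    using dr excl by (intro add_mono sum_mono) auto
  also have "\<dots> = 2 / 2 ^ t * loss k t * ?N + (2 ^ t - 2) * (2 / 2 ^ k * loss k t * ?N)"
  proof -
    have "W - {0, r} = W - {0} - {r}" by auto
    then have "real (card (W - {0, r})) = real (card (W - {0})) - 1"
      using r(1,2) card_Suc_Diff1[of "W - {0}" r] by (simp flip: of_nat_Suc)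
    then show ?thesis using cW by simp
  qed
  finally show ?thesis using q n by (simp add: algebra_simps)
qed

section \<open>Contradiction between the lower and upper bounds\<close>

lemma degree_bound_contradiction:
  assumes \<F>: "\<F> \<subseteq> subspaces_of_dim scale k" "\<And>F G. F \<in> \<F> \<Longrightarrow> G \<in> \<F> \<Longrightarrow> meets F G"
    and d: "2 \<le> d" "d < k" and nk: "2 * k + 1 \<le> n"
    and m: "\<And>S. S \<in> subspaces_of_dim scale d \<Longrightarrow> m \<le> real (degree_of \<F> S)"
    and gt: "m > star_size q n k (Suc d)"
  shows False
proof -
  have q2: "q \<ge> 2"
    using q_gt_1 by (simp add: q_eq)
  let ?N = "star_size q n k 1"
  have N: "?N > 0" using star_size_pos[OF q_gt_1] nk by simp
  have m0: "m > 0" using gt star_size_pos[OF q_gt_1, of k n "Suc d"] nk by simp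
  obtain W where W: "subspace W" "\<And>F. F \<in> \<F> \<Longrightarrow> meets F W" and
    Wmin: "\<And>E. subspace E \<Longrightarrow> (\<forall>F\<in>\<F>. meets F E) \<Longrightarrow> dim W \<le> dim E"
  proof -
    have "subspace UNIV \<and> (\<forall>F\<in>\<F>. meets F UNIV)" using \<F>(2) by (auto simp: meets_def)
    then show thesis
      using ex_has_least_nat[of "\<lambda>E. subspace E \<and> (\<forall>F\<in>\<F>. meets F E)" UNIV dim] that by blast
  qed
  define t where "t = dim W"
  have t: "covering_number_ge \<F> t"
    unfolding covering_number_ge_def t_def using Wmin meets_commute by (meson not_le)
  have pos: "(\<Prod>i<d. (q ^ n - q ^ (t + i)) / (q ^ k - q ^ Suc i)) > 0" if "t \<le> k"
    using q_gt_1 that nk d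
    by (intro prod_pos divide_pos_pos) (auto intro!: power_strict_increasing simp del: power_Suc)
  \<comment> \<open>Conditional on \<open>t \<le> k\<close>, because it first serves with
    \<open>t = 0\<close> to show that \<open>\<F>\<close> is nonempty, and only a member yields
    \<open>t \<le> k\<close>.\<close>
  have lower: "m * (\<Prod>i<d. (q ^ n - q ^ (t + i)) / (q ^ k - q ^ Suc i)) \<le> real (card \<F>)" if "t \<le> k"
    unfolding t_def using W d m m0 nk that t_def by (intro card_ge_if_all_meet[OF \<F>(1)]) auto
  have "\<F> \<noteq> {}"
  proof
    assume "\<F> = {}"
    then have "t \<le> 0" unfolding t_def using Wmin[of "{0}"] by simp
    then show False using lower pos m0 \<open>\<F> = {}\<close> by (auto simp: mult_le_0_iff)
  qed
  then obtain F0 where F0: "F0 \<in> \<F>" by auto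
  then have tk: "t \<le> k"
    unfolding t_def using Wmin[of F0] \<F> by (force simp: subspaces_of_dim_def)
  have "t \<noteq> 0"
  proof
    assume "t = 0"
    then have "W \<subseteq> {0}" unfolding t_def by simp
    then show False using W(2)[OF F0] by (auto simp: meets_def)
  qed
  have lower2: "?N * (\<Prod>i<d. (q ^ n - q ^ (t + i)) / (q ^ n - q ^ Suc i)) < real (card \<F>)"
    using lower[OF tk] mult_strict_right_mono[OF gt pos[OF tk]] star_size_split[OF q_gt_1 d(2), of n t] tk nk d
    by simp
  have upper: "real (card \<F>) \<le> ((q + 1) * (q ^ (2 * k) / q ^ n) / (q - 1)) ^ (t - 1) * ?N"
  proof (rule easy_size_bound[OF q_gt_1 _ tk])
    show "(q - 1) ^ t * real (card \<F>) \<le> (q ^ t - 1) * (q ^ k - 1) ^ (t - 1) * star_size q n k t"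
      using \<open>t \<noteq> 0\<close> nk
      by (intro card_le_if_covered[OF \<F> t _ tk _ W(1) t_def[symmetric] W(2)]) auto
  qed (use \<open>t \<noteq> 0\<close> nk in auto)
  show False
  proof (cases "t = 1")
    case True
    \<comment> \<open>For \<open>t = 1\<close> both bounds equal \<open>?N\<close>, and the lower
      one is strict.\<close>
    have "(\<Prod>i<d. (q ^ n - q ^ (t + i)) / (q ^ n - q ^ Suc i)) = 1"
    proof (rule prod.neutral, rule ballI)
      fix i assume "i \<in> {..<d}"
      then have "q ^ Suc i < q ^ n" using d nk q_gt_1 by (intro power_strict_increasing) auto
      then show "(q ^ n - q ^ (t + i)) / (q ^ n - q ^ Suc i) = 1" using True by simp
    qed
    then show False using lower2 upper True by simp
  next
    case False
    then have t2: "t \<ge> 2" using \<open>t \<noteq> 0\<close> by simp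
    have lower3: "?N * (1 - q ^ (t + d) / q ^ n) < real (card \<F>)"
    proof -
      have "?N * (1 - q ^ (t + d) / q ^ n) \<le>
          ?N * (\<Prod>i<d. (q ^ n - q ^ (t + i)) / (q ^ n - q ^ Suc i))"
        using d nk tk N q2 by (intro mult_left_mono prod_ratio_ge) auto
      then show ?thesis using lower2 by linarith
    qed
    show False
    proof (cases "q \<ge> 3 \<and> 2 * k + 1 \<le> n \<or> q = 2 \<and> 2 * k + 2 \<le> n")
      case True
      define c where "c = (q + 1) * (q ^ (2 * k) / q ^ n) / (q - 1)"
      have c: "0 \<le> c" "c \<le> 3 / 4"
        unfolding c_def using easy_factor_le[OF True] q_gt_1 by auto
      then have "c ^ (t - 1) \<le> c ^ 1" using t2 by (intro power_decreasing) auto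
      then have "c ^ (t - 1) * ?N \<le> 3 / 4 * ?N" using c N by (intro mult_right_mono) auto
      then have "real (card \<F>) \<le> 3 / 4 * ?N" using upper unfolding c_def by linarith
      moreover have "q ^ (t + d) / q ^ n \<le> 1 / 4"
      proof -
        \<comment> \<open>\<open>t \<le> k\<close> and \<open>d \<le> k - 1\<close> leave two powers
          of \<open>q\<close> to spare.\<close>
        have "q ^ (t + d) * q ^ 2 \<le> q ^ n"
          using tk d nk q_gt_1 by (simp only: power_add[symmetric]) (intro power_increasing, auto)
        moreover have "q ^ 2 \<ge> 2 ^ 2" using q2 by (intro power_mono) auto
        then have "q ^ (t + d) * 4 \<le> q ^ (t + d) * q ^ 2" using q_gt_1 by (intro mult_left_mono) auto
        ultimately have "q ^ (t + d) * 4 \<le> q ^ n" by linarith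
        then show ?thesis using q_gt_1 by (simp add: field_simps)
      qed
      then have "?N * (3 / 4) \<le> ?N * (1 - q ^ (t + d) / q ^ n)" using N by (intro mult_left_mono) auto
      ultimately show False using lower3 by linarith
    next
      case False
      have "CARD('a) = 2 \<or> CARD('a) \<ge> 3" using q2 by (auto simp: q_eq)
      then have q: "q = 2" and n: "n = 2 * k + 1" using False nk by (auto simp: q_eq)
      have "real (card \<F>) \<le> loss k t * (2 / 2 ^ t + (2 ^ t - 2) * (2 / 2 ^ k)) * ?N"
        using W by (intro binary_card_le[OF \<F> t t2 tk q n, of W]) (auto simp: t_def)
      also have "\<dots> \<le> (1 - 2 ^ t / (4 * 2 ^ k)) * ?N"
        using t2 tk d N by (intro mult_right_mono binary_factor_le) auto
      also have "\<dots> \<le> (1 - q ^ (t + d) / q ^ n) * ?N"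
      proof (intro mult_right_mono diff_left_mono)
        \<comment> \<open>Only \<open>d \<le> k - 1\<close> is used, the extreme case built into
          \<open>binary_factor_le\<close>.\<close>
        have "(2::real) ^ (t + d) * (4 * 2 ^ k) = 2 ^ (t + d + k + 2)" by (simp add: power_add)
        also have "\<dots> \<le> 2 ^ (t + (2 * k + 1))" using d by (intro power_increasing) auto
        also have "\<dots> = 2 ^ t * 2 ^ (2 * k + 1)" by (simp add: power_add)
        finally show "q ^ (t + d) / q ^ n \<le> 2 ^ t / (4 * 2 ^ k)"
          unfolding q n by (simp add: divide_simps mult.commute)
      qed (use N in auto)
      finally show False using lower3 by (simp add: mult.commute)
    qed
  qed
qed

end

section \<open>Transfer to the minimum degree and the Gaussian coefficient\<close>

theorem theorem1p4:
  fixes scale :: "'a::{field,finite} \<Rightarrow> 'b::ab_group_add \<Rightarrow> 'b"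
    and q n k d :: nat
    and \<F> :: "'b set set"
  assumes "primepow q" and "CARD('a) = q"
    and "k > d" and "d \<ge> 2" and "n \<ge> 2 * k + 1"
    and "vector_space scale"
    and "vector_space.dim scale (UNIV :: 'b set) = n"
    and "\<F> \<subseteq> subspaces_of_dim scale k"
    and "intersecting_family scale \<F>"
  shows "real (min_degree scale d \<F>)
           \<le> gauss_binomial q (real n - real d - 1) (int k - int d - 1)"
proof (rule ccontr)
  assume neg: "\<not> ?thesis"
  interpret vs: vector_space scale by fact
  obtain Basis where B: "vs.independent Basis" "UNIV \<subseteq> vs.span Basis" "card Basis = n"
    using vs.basis_exists[of UNIV] assms(7) by blast
  \<comment> \<open>\<open>card\<close> of an infinite set is 0, whereas
    \<open>card Basis = n\<close> is positive.\<close>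
  have "finite Basis" using B(3) assms(5) by (intro card_ge_0_finite) simp
  then interpret V: finite_field_space scale Basis "real q"
    using B assms(2) by unfold_locales auto
  have "q > 1" using V.q_gt_1 by simp
  have meets: "meets F G" if "F \<in> \<F>" "G \<in> \<F>" for F G
  proof -
    have "vs.dim (F \<inter> G) \<ge> 1" using assms(9) that by (auto simp: intersecting_family_def)
    then have "\<not> F \<inter> G \<subseteq> {0}" using V.dim_eq_0[of "F \<inter> G"] by linarith
    then show ?thesis by (auto simp: meets_def)
  qed
  have "min_degree scale d \<F> \<le> degree_of \<F> S" if "S \<in> subspaces_of_dim scale d" for S
  proof -
    \<comment> \<open>As an image the set of degrees is visibly finite, as \<open>Min_le\<close>
      requires.\<close>
    have "{degree_of \<F> S |S. S \<in> subspaces_of_dim scale d} = degree_of \<F> ` subspaces_of_dim scale d"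
      by auto
    then show ?thesis unfolding min_degree_def using that by (auto intro!: Min_le)
  qed
  then show False
    using neg gauss_binomial_eq_star_size[OF \<open>q > 1\<close>, of d k n] assms(3-5) B(3)
    by (intro V.degree_bound_contradiction[OF assms(8) meets, of d "real (min_degree scale d \<F>)"]) auto
qed

end
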